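(* Let $S$ be an Arf numerical semigroup with multiplicity $5$ and conductor $s>5$. If $s\equiv 2\bmod 5$, then $S=\langle 5,s,s+1,s+2,s+4\rangle$, $\mathrm{PF}(S)=\{s-5,s-4,s-3,s-1\}$, and the row-factorization matrices are exactly the following $5\times5$ matrices, described by their rows $r_1,\dots,r_5$ in order (where alternatives for different rows are chosen independently). For $s-5$ (one matrix): $r_1=(-1,1,0,0,0)$, $r_2=(\frac{s-7}{5},-1,0,1,0)$, $r_3=(\frac{2s-4}{5},0,-1,0,0)$, $r_4=(\frac{s-7}{5},0,0,-1,1)$, $r_5=(\frac{s-2}{5},0,1,0,-1)$. For $s-4$ (two matrices): $r_1=(-1,0,1,0,0)$, $r_2=(\frac{2s-4}{5},-1,0,0,0)$, $r_3=(\frac{s-7}{5},0,-1,0,1)$, $r_4=(\frac{s-2}{5},1,0,-1,0)$, and $r_5=(\frac{s-2}{5},0,0,1,-1)$ or $r_5=(0,2,0,0,-1)$. For $s-3$ (two matrices): $r_1=(-1,0,0,1,0)$, $r_2=(\frac{s-7}{5},-1,0,0,1)$, $r_3=(\frac{s-2}{5},1,-1,0,0)$, $r_4=(\frac{s-2}{5},0,1,-1,0)$, and $r_5=(\frac{2s+1}{5},0,0,0,-1)$ or $r_5=(0,1,1,0,-1)$. For $s-1$ (eight matrices): $r_1=(-1,0,0,0,1)$, $r_2=(\frac{s-2}{5},-1,1,0,0)$, $r_3=(\frac{s-2}{5},0,-1,1,0)$ or $r_3=(0,2,-1,0,0)$, $r_4=(\frac{2s+1}{5},0,0,-1,0)$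 or $r_4=(0,1,1,-1,0)$, and $r_5=(\frac{s+3}{5},1,0,0,-1)$ or $r_5=(0,0,1,1,-1)$.
   Context: A numerical semigroup is a subset $S\subseteq\mathbb{N}_0$ (non-negative integers) containing $0$, closed under addition, with finite complement in $\mathbb{N}_0$; $\langle A\rangle$ is the set of $\mathbb{N}_0$-linear combinations of elements of $A$. The multiplicity is the smallest nonzero element of $S$; the conductor is one plus the greatest integer not in $S$. $S$ is Arf if $s_2+s_3-s_1\in S$ for all $s_1\le s_2\le s_3$ in $S$. $\mathrm{PF}(S)$ is the set of integers $z\notin S$ with $z+x\in S$ for all nonzero $x\in S$. If $n_1<\dots<n_e$ are the minimal generators of $S$, a row-factorization matrix of $f\in\mathrm{PF}(S)$ is an $e\times e$ integer matrix $[a_{ij}]$ with $a_{ii}=-1$, $a_{ij}\in\mathbb{N}_0$ for $i\ne j$, and $f=\sum_{j=1}^e a_{ij}n_j$ for each $i$. *)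

theory Defs
  imports "Jordan_Normal_Form.Matrix"
begin

definition numerical_semigroup :: "nat set \<Rightarrow> bool" where
  "numerical_semigroup S \<longleftrightarrow>
     0 \<in> S \<and> (\<forall>x\<in>S. \<forall>y\<in>S. x + y \<in> S) \<and> finite (UNIV - S)"

definition generated :: "nat set \<Rightarrow> nat set" where
  "generated A = {(\<Sum>a\<in>B. c a * a) | B c. finite B \<and> B \<subseteq> A}"

definition multiplicity_of :: "nat set \<Rightarrow> nat" where
  "multiplicity_of S = (LEAST x. x \<in> S \<and> x \<noteq> 0)"

(* The greatest element is taken over the integers, so that the Frobenius number of the
   full semigroup of natural numbers is -1 and its conductor is 0. *)
definition frobenius_number :: "nat set \<Rightarrow> int" where
  "frobenius_number S = (GREATEST z. z \<notin> int ` S)"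

definition conductor :: "nat set \<Rightarrow> int" where
  "conductor S = frobenius_number S + 1"

(* The subtraction does not truncate, since s1 <= s2. *)
definition arf :: "nat set \<Rightarrow> bool" where
  "arf S \<longleftrightarrow>
     (\<forall>s1\<in>S. \<forall>s2\<in>S. \<forall>s3\<in>S. s1 \<le> s2 \<and> s2 \<le> s3 \<longrightarrow> s2 + s3 - s1 \<in> S)"

definition pseudo_frobenius :: "nat set \<Rightarrow> int set" where
  "pseudo_frobenius S =
     {z. z \<notin> int ` S \<and> (\<forall>x\<in>S. x \<noteq> 0 \<longrightarrow> z + int x \<in> int ` S)}"

(* Every numerical semigroup has exactly one generating set that is minimal with respect to
   inclusion, and this set is finite. *)
definition minimal_generators :: "nat set \<Rightarrow> nat set" where
  "minimal_generators S =
     (THE A. generated A = S \<and> (\<forall>B. B \<subset> A \<longrightarrow> generated B \<noteq> S))"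

(* Matrix indices start at 0: column j belongs to the (j+1)-st smallest minimal generator.
   The notion is only meant for f in pseudo_frobenius S. *)
definition row_factorization_matrices :: "nat set \<Rightarrow> int \<Rightarrow> int mat set" where
  "row_factorization_matrices S f =
     (let ns = sorted_list_of_set (minimal_generators S); e = length ns in
      {M \<in> carrier_mat e e. \<forall>i<e.
         M $$ (i, i) = -1 \<and>
         (\<forall>j<e. j \<noteq> i \<longrightarrow> M $$ (i, j) \<ge> 0) \<and>
         f = (\<Sum>j<e. M $$ (i, j) * int (ns ! j))})"

end

theory Submission
  imports Defs
begin

text \<open>The Arf property forces every element below the conductor \<open>s = 5 * k + 2\<close> to be a multiple
  of 5, because a non-multiple would generate elements congruent to 1 up to \<open>s - 1\<close>, which is a
  gap (\<open>arf_below_conductor\<close>). Hence the semigroup is explicitly \<open>{x. 5 dvd x \<or> s \<le> x}\<close>, and its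
  generators and pseudo-Frobenius numbers can be read off.

  The rows of a row-factorization matrix are independent of each other, and row \<open>i\<close> for \<open>f\<close> is the
  same thing as a factorization of \<open>f + n\<^sub>i\<close> in which \<open>n\<^sub>i\<close> does not occur
  (\<open>rf_rows_eq_factorizations\<close>). The twenty rows thus only involve the factorizations of twelve
  values. All of these are below \<open>3 * s\<close>, so at most two generators other than 5 occur, and the
  residue modulo 5 decides which of the fifteen combinations are possible
  (\<open>factorizations_table\<close>). The alternatives arise at \<open>2 * s\<close>, \<open>2 * s + 1\<close> and \<open>2 * s + 3\<close>, which
  have a second factorization, without the generator 5.\<close>

section \<open>Generating sets and irreducible elements\<close>

lemma generated_subset:
  assumes "0 \<in> S" and add: "\<And>x y. x \<in> S \<Longrightarrow> y \<in> S \<Longrightarrow> x + y \<in> S" and "A \<subseteq> S"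
  shows "generated A \<subseteq> S"
proof
  fix x assume "x \<in> generated A"
  then obtain B c where B: "finite B" "B \<subseteq> A" and x: "x = (\<Sum>a\<in>B. c a * a)"
    by (auto simp: generated_def)
  have mult: "n * a \<in> S" if "a \<in> S" for n a
    by (induction n) (use assms that in auto)
  from B have "(\<Sum>a\<in>B. c a * a) \<in> S"
    by (induction rule: finite_induct) (use assms mult in auto)
  with x show "x \<in> S" by simp
qed

lemma multiple_in_generated: "a \<in> A \<Longrightarrow> n * a \<in> generated A"
  unfolding generated_def by (intro CollectI exI[of _ "{a}"] exI[of _ "\<lambda>_. n"]) auto

lemma multiple_add_generator_in_generated:
  assumes "a \<in> A" "b \<in> A"
  shows "n * a + b \<in> generated A"
proof (cases "a = b")
  case True
  then show ?thesis using multiple_in_generated[OF assms(1), of "Suc n"] by (simp add: add.commute)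
next
  case False
  then show ?thesis using assms unfolding generated_def
    by (intro CollectI exI[of _ "{a, b}"] exI[of _ "\<lambda>x. if x = a then n else 1"]) auto
qed

definition irreducible_in :: "nat set \<Rightarrow> nat \<Rightarrow> bool" where
  "irreducible_in S x \<longleftrightarrow>
     x \<in> S \<and> x \<noteq> 0 \<and> (\<forall>y\<in>S. \<forall>z\<in>S. x = y + z \<longrightarrow> y = 0 \<or> z = 0)"

text \<open>Splitting off one copy of a generator that occurs in a representation of an irreducible
  element leaves a remainder that must vanish, so the element is that generator.\<close>

lemma irreducible_mem_generators:
  assumes "irreducible_in (generated A) x"
  shows "x \<in> A"
proof -
  obtain B c where B: "finite B" "B \<subseteq> A" and x: "x = (\<Sum>a\<in>B. c a * a)"
    using assms by (auto simp: irreducible_in_def generated_def)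
  have "x \<noteq> 0" using assms by (simp add: irreducible_in_def)
  with x B obtain a where a: "a \<in> B" "c a \<noteq> 0" "a \<noteq> 0"
    by (metis (no_types, lifting) mult_is_0 sum.neutral)
  define c' where "c' = c(a := c a - 1)"
  define y where "y = (\<Sum>b\<in>B. c' b * b)"
  have "y \<in> generated A" using B by (auto simp: generated_def y_def)
  moreover have "a \<in> generated A" using multiple_in_generated[of a A 1] a B by auto
  moreover have "x = a + y"
  proof -
    have "(\<Sum>b\<in>B - {a}. c' b * b) = (\<Sum>b\<in>B - {a}. c b * b)"
      by (rule sum.cong) (auto simp: c'_def)
    moreover have "c a * a = a + c' a * a" using a by (cases "c a") (auto simp: c'_def)
    ultimately show ?thesis
      unfolding x y_def sum.remove[OF B(1) a(1)] by simp
  qed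
  ultimately have "y = 0" using assms a by (auto simp: irreducible_in_def)
  with \<open>x = a + y\<close> a B show ?thesis by auto
qed

text \<open>Every generating set contains all irreducible elements. A generating set that consists of
  irreducible elements is therefore the least generating set, hence the only minimal one.\<close>

lemma minimal_generators_eqI:
  assumes gen: "generated G = S" and irr: "\<And>g. g \<in> G \<Longrightarrow> irreducible_in S g"
  shows "minimal_generators S = G"
proof -
  have least: "G \<subseteq> A" if "generated A = S" for A
    using irr irreducible_mem_generators that by blast
  show ?thesis unfolding minimal_generators_def
  proof (rule the_equality)
    show "generated G = S \<and> (\<forall>B. B \<subset> G \<longrightarrow> generated B \<noteq> S)"
      using gen least by blast
    show "A = G" if "generated A = S \<and> (\<forall>B. B \<subset> A \<longrightarrow> generated B \<noteq> S)" for A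
      using that gen least[of A] by blast
  qed
qed

section \<open>The Frobenius number\<close>

text \<open>The integers outside a numerical semigroup include \<open>-1\<close>, and only finitely many of
  them are larger, so a greatest one exists.\<close>

lemma frobenius_number_greatest:
  assumes "numerical_semigroup S"
  shows "frobenius_number S \<notin> int ` S" "\<And>z. z > frobenius_number S \<Longrightarrow> z \<in> int ` S"
proof -
  define N where "N = {z. z \<notin> int ` S \<and> z \<ge> -1}"
  have "N \<subseteq> insert (-1) (int ` (UNIV - S))"
  proof
    fix z assume z: "z \<in> N"
    show "z \<in> insert (-1) (int ` (UNIV - S))"
    proof (cases "z \<ge> 0")
      case True
      then have "z = int (nat z)" by simp
      with z show ?thesis unfolding N_def
        by (metis (mono_tags, lifting) DiffI UNIV_I imageI insertI2 mem_Collect_eq)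
    qed (use z in \<open>auto simp: N_def\<close>)
  qed
  then have fin: "finite N" using assms by (auto simp: numerical_semigroup_def intro: finite_subset)
  have "-1 \<in> N" by (auto simp: N_def)
  then have Max: "Max N \<in> N" using fin Max_in by blast
  have bound: "z \<le> Max N" if "z \<notin> int ` S" for z
  proof (cases "z \<ge> -1")
    case True
    then show ?thesis using that fin by (auto simp: N_def)
  next
    case False
    then show ?thesis using Max by (auto simp: N_def)
  qed
  have "frobenius_number S = Max N" unfolding frobenius_number_def
    by (rule Greatest_equality) (use Max bound in \<open>auto simp: N_def\<close>)
  then show "frobenius_number S \<notin> int ` S" "\<And>z. z > frobenius_number S \<Longrightarrow> z \<in> int ` S"
    using Max bound by (auto simp: N_def linorder_not_less[symmetric])
qed

section \<open>Shape of the semigroup\<close>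

text \<open>Let \<open>5 * p + r\<close> with \<open>0 < r < 5\<close> be an element below \<open>5 * k + 2\<close>. For \<open>r \<noteq> 1\<close> the Arf
  property yields \<open>5 * p + 6\<close>, which is still at most \<open>5 * k + 1\<close>. So in every case there is an
  element congruent to 1 in this range, and adding fives to it reaches the gap \<open>5 * k + 1\<close>.\<close>

lemma arf_below_conductor:
  assumes add: "\<And>x y. x \<in> S \<Longrightarrow> y \<in> S \<Longrightarrow> x + y \<in> S" and zero: "0 \<in> S"
    and arf: "arf S" and five: "5 \<in> S"
    and gap: "5 * k + 1 \<notin> S"
    and x: "x \<in> S" "x < 5 * k + 2"
  shows "5 dvd x"
proof (rule ccontr)
  assume ndvd: "\<not> 5 dvd x"
  have mult5: "5 * n \<in> S" for n
    by (induction n) (use zero add[OF five] in auto)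
  define p where "p = x div 5"
  define r where "r = x mod 5"
  have xpr: "x = 5 * p + r" by (simp add: p_def r_def)
  have "r < 5" by (simp add: r_def)
  moreover have "r \<noteq> 0" using ndvd by (simp add: r_def dvd_eq_mod_eq_0)
  ultimately consider (r1) "r = 1" | (r2) "r = 2" | (r3) "r = 3" | (r4) "r = 4" by linarith
  note r_cases = this
  have no1: "5 * m + 1 \<notin> S" if "m \<le> k" for m
  proof
    assume "5 * m + 1 \<in> S"
    from add[OF this mult5[of "k - m"]] that have "5 * k + 1 \<in> S"
      by (simp add: diff_mult_distrib2)
    with gap show False by simp
  qed
  have "p \<le> k" using x xpr by linarith
  have p: "p + 1 \<le> k" if "r \<noteq> 1"
    using x xpr that \<open>r \<noteq> 0\<close> by linarith
  have rule: "s2 + s3 - s1 \<in> S" if "s1 \<in> S" "s2 \<in> S" "s3 \<in> S" "s1 \<le> s2" "s2 \<le> s3" for s1 s2 s3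
    using arf that unfolding arf_def by blast
  have p6: "5 * p + 6 \<in> S" if "r \<noteq> 1"
    using r_cases
  proof cases
    case r1
    with that show ?thesis by simp
  next
    case r2
    then have "5 * p + 2 \<in> S" using x xpr by simp
    from rule[OF mult5[of p] this this] have "5 * p + 4 \<in> S" by simp
    from rule[OF \<open>5 * p + 2 \<in> S\<close> this this] have "6 + 5 * p \<in> S" by simp
    then show ?thesis by (metis add.commute)
  next
    case r3
    then have "5 * p + 3 \<in> S" using x xpr by simp
    from rule[OF mult5[of p] this this] show ?thesis by simp
  next
    case r4
    then have "5 * p + 4 \<in> S" using x xpr by simp
    from rule[OF this mult5[of "p + 1"] mult5[of "p + 1"]]
    show ?thesis by (simp add: algebra_simps)
  qed
  show False
  proof (cases "r = 1")
    case True
    then show False using no1[of p] \<open>p \<le> k\<close> x xpr by simp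
  next
    case False
    moreover have "5 * (p + 1) + 1 = 5 * p + 6" by simp
    ultimately show False using no1[of "p + 1"] p p6 by metis
  qed
qed

text \<open>For each nonzero residue class modulo 5, the generators contain the least element of the
  class that is at least \<open>s\<close>; the remaining ones differ from it by multiples of 5. The number
  \<open>s + 3\<close> is absent because it is itself a multiple of 5.\<close>

lemma generated_multiples_of_5_or_ge:
  assumes s: "s = 5 * k + 2"
  shows "generated {5, s, s + 1, s + 2, s + 4} = {x. 5 dvd x \<or> s \<le> x}" (is "generated ?G = ?T")
proof
  show "generated ?G \<subseteq> ?T" by (rule generated_subset) auto
  show "?T \<subseteq> generated ?G"
  proof
    fix x assume "x \<in> ?T"
    then have x: "5 dvd x \<or> s \<le> x" by simp
    show "x \<in> generated ?G"
    proof (cases "5 dvd x")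
      case True
      then obtain n where "x = n * 5" by (auto simp: mult.commute)
      then show ?thesis using multiple_in_generated[of 5 ?G n] by simp
    next
      case False
      have *: "x \<in> generated ?G" if "g \<in> ?G" "g \<le> x" "5 dvd x - g" for g
      proof -
        obtain n where "x - g = n * 5" using \<open>5 dvd x - g\<close> by (metis dvd_def mult.commute)
        then show ?thesis using multiple_add_generator_in_generated[of 5 ?G g n] that(1,2)
          by (metis insertI1 le_add_diff_inverse2)
      qed
      define y where "y = x - s"
      have mod5: "c \<le> y \<and> 5 dvd y - c" if "y mod 5 = c" for c
        using that by (auto simp: minus_mod_eq_div_mult[symmetric])
      have y: "x = s + y" using x False by (simp add: y_def)
      have "y mod 5 < 5" by simp
      moreover have "y mod 5 \<noteq> 3" using False unfolding y s by presburger
      ultimately consider "y mod 5 = 0" | "y mod 5 = 1" | "y mod 5 = 2" | "y mod 5 = 4"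
        by linarith
      then show ?thesis
      proof cases
        case 1 then show ?thesis using *[of s] y by auto
      next
        case 2
        then show ?thesis using *[of "s + 1"] y mod5[of 1] by simp
      next
        case 3
        then show ?thesis using *[of "s + 2"] y mod5[of 2] by simp
      next
        case 4
        then show ?thesis using *[of "s + 4"] y mod5[of 4] by simp
      qed
    qed
  qed
qed

text \<open>If two nonzero elements, hence elements of size at least 5, add up to at most \<open>s + 4\<close>, then
  both are below \<open>s\<close>. They are therefore multiples of 5, unlike every generator except 5.\<close>

lemma minimal_generators_multiples_of_5_or_ge:
  assumes s: "s = 5 * k + 2" "s > 5"
  shows "minimal_generators {x. 5 dvd x \<or> s \<le> x} = {5, s, s + 1, s + 2, s + 4}"
proof (rule minimal_generators_eqI[OF generated_multiples_of_5_or_ge[OF s(1)]])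
  fix g assume g: "g \<in> {5, s, s + 1, s + 2, s + 4}"
  have "y = 0 \<or> z = 0"
    if y: "5 dvd y \<or> s \<le> y" and z: "5 dvd z \<or> s \<le> z" and g_eq: "g = y + z" for y z
  proof (rule ccontr)
    assume "\<not> ?thesis"
    then have pos: "y \<ge> 5" "z \<ge> 5" using y z s(2) by (auto dest: dvd_imp_le)
    with g_eq g have "g \<noteq> 5" by auto
    have lt: "y < s" "z < s" using pos g g_eq by auto
    with y z have "5 dvd g" using g_eq by auto
    then show False using g \<open>g \<noteq> 5\<close> s(1) by auto presburger+
  qed
  then show "irreducible_in {x. 5 dvd x \<or> s \<le> x} g"
    using g s(2) by (auto simp: irreducible_in_def)
qed

lemma pseudo_frobenius_multiples_of_5_or_ge:
  assumes s: "s = 5 * k + 2" "s > 5"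
  shows "pseudo_frobenius {x. 5 dvd x \<or> s \<le> x} = {int s - 5, int s - 4, int s - 3, int s - 1}"
    (is "pseudo_frobenius ?T = ?P")
proof -
  have T: "z \<in> int ` ?T \<longleftrightarrow> z \<ge> 0 \<and> (5 dvd z \<or> int s \<le> z)" for z
  proof
    assume "z \<ge> 0 \<and> (5 dvd z \<or> int s \<le> z)"
    then show "z \<in> int ` ?T"
      by (intro image_eqI[of _ _ "nat z"]) (auto simp: nat_le_iff le_nat_iff, presburger)
  qed auto
  show ?thesis
  proof (intro equalityI subsetI)
    fix z assume "z \<in> pseudo_frobenius ?T"
    then have z: "z \<notin> int ` ?T" and add: "\<And>x. x \<in> ?T \<Longrightarrow> x \<noteq> 0 \<Longrightarrow> z + int x \<in> int ` ?T"
      by (auto simp: pseudo_frobenius_def)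
    have "z + 5 \<in> int ` ?T" "z + int (s + 1) \<in> int ` ?T"
      using add[of 5] add[of "s + 1"] by auto
    \<comment> \<open>The generator 5 leaves only \<open>-5\<close> and the five integers before \<open>s\<close>;
      \<open>-5\<close> is ruled out by \<open>s + 1\<close>.\<close>
    with z have "z \<ge> int s - 5" "z < int s" "\<not> 5 dvd z" unfolding T using s
      by presburger+
    then show "z \<in> ?P" using s by auto presburger
  next
    fix z assume z: "z \<in> ?P"
    have "z \<notin> int ` ?T" unfolding T using z s by auto presburger+
    moreover have "z + int x \<in> int ` ?T" if "x \<in> ?T" "x \<noteq> 0" for x
    proof -
      have "x \<ge> 5" using that s by (auto dest: dvd_imp_le)
      then show ?thesis unfolding T using z s by auto
    qed
    ultimately show "z \<in> pseudo_frobenius ?T" by (auto simp: pseudo_frobenius_def)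
  qed
qed

section \<open>Rows as factorizations\<close>

definition factorizations :: "nat list \<Rightarrow> int \<Rightarrow> int list set" where
  "factorizations ns v = {x. length x = length ns \<and> (\<forall>j<length ns. 0 \<le> x ! j) \<and>
     (\<Sum>j<length ns. x ! j * int (ns ! j)) = v}"

definition rf_rows :: "nat list \<Rightarrow> int \<Rightarrow> nat \<Rightarrow> int list set" where
  "rf_rows ns f i = {r. length r = length ns \<and> r ! i = -1 \<and>
     (\<forall>j<length ns. j \<noteq> i \<longrightarrow> r ! j \<ge> 0) \<and> f = (\<Sum>j<length ns. r ! j * int (ns ! j))}"

text \<open>Moving the diagonal entry \<open>-1\<close> to the other side turns row \<open>i\<close> of a matrix for \<open>f\<close> into
  a factorization of \<open>f + n\<^sub>i\<close> that avoids \<open>n\<^sub>i\<close>. Rows of different matrices with the same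
  value of \<open>f + n\<^sub>i\<close> thus come from one set of factorizations.\<close>

lemma rf_rows_eq_factorizations:
  assumes i: "i < length ns"
  shows "rf_rows ns f i =
    (\<lambda>x. x[i := -1]) ` {x \<in> factorizations ns (f + int (ns ! i)). x ! i = 0}"
proof -
  have split: "(\<Sum>j<length ns. x[i := c] ! j * int (ns ! j)) =
      c * int (ns ! i) + (\<Sum>j\<in>{..<length ns} - {i}. x ! j * int (ns ! j))"
    if "length x = length ns" for x :: "int list" and c
    unfolding sum.remove[of "{..<length ns}" i, OF finite_lessThan, simplified, OF i]
    using i that by (auto intro!: sum.cong)
  have split_id: "(\<Sum>j<length ns. x ! j * int (ns ! j)) =
      x ! i * int (ns ! i) + (\<Sum>j\<in>{..<length ns} - {i}. x ! j * int (ns ! j))"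
    if "length x = length ns" for x :: "int list"
    using split[OF that, of "x ! i"] by simp
  show ?thesis
  proof (intro equalityI subsetI)
    fix r assume r: "r \<in> rf_rows ns f i"
    then have len: "length r = length ns" by (simp add: rf_rows_def)
    have "r[i := 0] \<in> factorizations ns (f + int (ns ! i))"
      using r i split[OF len, of 0] split_id[OF len]
      by (auto simp: rf_rows_def factorizations_def nth_list_update)
    moreover have "r = (r[i := 0])[i := -1]" using r by (auto simp: rf_rows_def) (metis list_update_id)
    ultimately show "r \<in> (\<lambda>x. x[i := -1]) ` {x \<in> factorizations ns (f + int (ns ! i)). x ! i = 0}"
      using i len by (intro image_eqI[of _ _ "r[i := 0]"]) auto
  next
    fix r assume "r \<in> (\<lambda>x. x[i := -1]) ` {x \<in> factorizations ns (f + int (ns ! i)). x ! i = 0}"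
    then obtain x where x: "x \<in> factorizations ns (f + int (ns ! i))" "x ! i = 0" "r = x[i := -1]"
      by auto
    then have len: "length x = length ns" by (simp add: factorizations_def)
    show "r \<in> rf_rows ns f i"
      using x i split[OF len, of "-1"] split_id[OF len]
      by (auto simp: rf_rows_def factorizations_def nth_list_update)
  qed
qed

lemma mem_listset_iff:
  "xs \<in> listset As \<longleftrightarrow> length xs = length As \<and> (\<forall>i<length As. xs ! i \<in> As ! i)"
proof (induction As arbitrary: xs)
  case (Cons A As)
  show ?case
  proof (cases xs)
    case (Cons y ys)
    then show ?thesis using Cons.IH[of ys]
      by (auto simp: set_Cons_def nth_Cons split: nat.splits)
  qed (auto simp: set_Cons_def)
qed auto

lemma set_Cons_insert: "set_Cons (insert a A) B = (#) a ` B \<union> set_Cons A B"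
  by (auto simp: set_Cons_def)

lemma set_Cons_empty: "set_Cons {} B = {}"
  by (simp add: set_Cons_def)

text \<open>Counting matrices thereby becomes counting lists of rows.\<close>

lemma mat_of_rows_list_inj:
  "inj_on (mat_of_rows_list n) {rs. length rs = m \<and> (\<forall>r\<in>set rs. length r = n)}"
proof (rule inj_onI)
  fix rs ts :: "'a list list"
  assume rs: "rs \<in> {rs. length rs = m \<and> (\<forall>r\<in>set rs. length r = n)}"
    and ts: "ts \<in> {rs. length rs = m \<and> (\<forall>r\<in>set rs. length r = n)}"
    and eq: "mat_of_rows_list n rs = mat_of_rows_list n ts"
  have "rs ! i ! j = ts ! i ! j" if "i < m" "j < n" for i j
    using arg_cong[OF eq, of "\<lambda>M. M $$ (i, j)"] that rs ts by (simp add: mat_of_rows_list_def)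
  then show "rs = ts" using rs ts by (auto intro!: nth_equalityI)
qed

text \<open>The defining conditions constrain each row separately, so the matrices are all the
  independent choices of admissible rows.\<close>

lemma row_factorization_matrices_eq:
  assumes ns: "sorted_list_of_set (minimal_generators S) = ns" and e: "length ns = e"
  shows "row_factorization_matrices S f = mat_of_rows_list e ` listset (map (rf_rows ns f) [0..<e])"
proof (intro equalityI subsetI)
  fix M assume "M \<in> row_factorization_matrices S f"
  then have M: "M \<in> carrier_mat e e" "\<And>i. i < e \<Longrightarrow> M $$ (i, i) = -1"
    "\<And>i j. i < e \<Longrightarrow> j < e \<Longrightarrow> j \<noteq> i \<Longrightarrow> M $$ (i, j) \<ge> 0"
    "\<And>i. i < e \<Longrightarrow> f = (\<Sum>j<e. M $$ (i, j) * int (ns ! j))"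
    unfolding row_factorization_matrices_def Let_def ns e by auto
  define rs where "rs = map (\<lambda>i. map (\<lambda>j. M $$ (i, j)) [0..<e]) [0..<e]"
  have "M = mat_of_rows_list e rs"
    by (rule eq_matI) (use M in \<open>auto simp: mat_of_rows_list_def rs_def\<close>)
  moreover have "rs \<in> listset (map (rf_rows ns f) [0..<e])"
    using M(2-4) by (auto simp: mem_listset_iff rs_def rf_rows_def e)
  ultimately show "M \<in> mat_of_rows_list e ` listset (map (rf_rows ns f) [0..<e])" by blast
next
  fix M assume "M \<in> mat_of_rows_list e ` listset (map (rf_rows ns f) [0..<e])"
  then obtain rs where rs: "M = mat_of_rows_list e rs" "length rs = e"
      "\<And>i. i < e \<Longrightarrow> rs ! i \<in> rf_rows ns f i"
    by (auto simp: mem_listset_iff)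
  then show "M \<in> row_factorization_matrices S f"
    unfolding row_factorization_matrices_def Let_def ns e
    by (auto simp: mat_of_rows_list_def rf_rows_def e)
qed

lemma card_row_factorization_matrices:
  assumes "sorted_list_of_set (minimal_generators S) = ns" and "length ns = e"
  shows "card (row_factorization_matrices S f) = card (listset (map (rf_rows ns f) [0..<e]))"
proof -
  have "listset (map (rf_rows ns f) [0..<e]) \<subseteq> {rs. length rs = e \<and> (\<forall>r\<in>set rs. length r = e)}"
    using assms(2) by (auto simp: mem_listset_iff rf_rows_def in_set_conv_nth)
  then show ?thesis
    unfolding row_factorization_matrices_eq[OF assms]
    by (intro card_image inj_on_subset[OF mat_of_rows_list_inj])
qed

section \<open>The factorizations that occur\<close>

text \<open>Every generator other than 5 contributes at least \<open>s\<close>, so fewer than three of them fit into a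
  value below \<open>3 * s\<close>.\<close>

lemma at_most_two_large_generators:
  fixes a b c d e s v :: int
  assumes "0 \<le> a" "0 \<le> b" "0 \<le> c" "0 \<le> d" "0 \<le> e" "0 < s"
    and v: "5 * a + b * s + c * (s + 1) + d * (s + 2) + e * (s + 4) = v" "v < 3 * s"
  shows "(b, c, d, e) \<in> {(0,0,0,0), (1,0,0,0), (0,1,0,0), (0,0,1,0), (0,0,0,1),
    (2,0,0,0), (1,1,0,0), (1,0,1,0), (1,0,0,1), (0,2,0,0), (0,1,1,0), (0,1,0,1),
    (0,0,2,0), (0,0,1,1), (0,0,0,2)}"
proof -
  have "(b + c + d + e) * s \<le> v" unfolding v(1)[symmetric] using assms(1-5)
    by (simp add: algebra_simps)
  with v(2) have "(b + c + d + e) * s < 3 * s" by linarith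
  with \<open>0 < s\<close> have sum: "b + c + d + e < 3" by simp
  have "b = 0 \<or> b = 1 \<or> b = 2" "c = 0 \<or> c = 1 \<or> c = 2"
    "d = 0 \<or> d = 1 \<or> d = 2" "e = 0 \<or> e = 1 \<or> e = 2"
    using sum assms(2-5) by presburger+
  then show ?thesis by (elim disjE; use sum in simp)
qed

lemma all_less_Suc: "(\<forall>j<Suc n. P j) \<longleftrightarrow> (\<forall>j<n. P j) \<and> P n"
  by (auto simp: less_Suc_eq)

lemma mem_factorizations5_iff:
  "x \<in> factorizations [n0, n1, n2, n3, n4] v \<longleftrightarrow>
    (\<exists>a b c d e. x = [a, b, c, d, e] \<and> 0 \<le> a \<and> 0 \<le> b \<and> 0 \<le> c \<and> 0 \<le> d \<and> 0 \<le> e \<and>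
      a * int n0 + b * int n1 + c * int n2 + d * int n3 + e * int n4 = v)"
proof -
  have list5: "[a, b, c, d, e] \<in> factorizations [n0, n1, n2, n3, n4] v \<longleftrightarrow>
      0 \<le> a \<and> 0 \<le> b \<and> 0 \<le> c \<and> 0 \<le> d \<and> 0 \<le> e \<and>
      a * int n0 + b * int n1 + c * int n2 + d * int n3 + e * int n4 = v" for a b c d e
    by (simp add: factorizations_def all_less_Suc lessThan_Suc ac_simps)
  have "\<exists>a b c d e. x = [a, b, c, d, e]" if "x \<in> factorizations [n0, n1, n2, n3, n4] v"
  proof -
    have "length x = Suc (Suc (Suc (Suc (Suc 0))))" using that by (simp add: factorizations_def)
    then show ?thesis by (auto simp: length_Suc_conv)
  qed
  then show ?thesis using list5 by metis
qed

text \<open>Each of the fifteen combinations of large generators leaves an equation \<open>5 * a = w\<close> with \<open>w\<close>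
  linear in \<open>k\<close>; it is solvable exactly when the constant term of \<open>w\<close> is a multiple of 5 and \<open>w\<close>
  is not negative.\<close>

lemma factorizations_table:
  fixes k :: int
  assumes s: "int s = 5 * k + 2" and k: "1 \<le> k"
  defines "F \<equiv> factorizations [5, s, s + 1, s + 2, s + 4]"
  shows "F (int s) = {[0, 1, 0, 0, 0]}"
    and "F (int s + 1) = {[0, 0, 1, 0, 0]}"
    and "F (int s + 2) = {[0, 0, 0, 1, 0]}"
    and "F (int s + 4) = {[0, 0, 0, 0, 1]}"
    and "F (2 * int s - 5) = {[k - 1, 0, 0, 1, 0]}"
    and "F (2 * int s - 4) = {[2 * k, 0, 0, 0, 0]}"
    and "F (2 * int s - 3) = {[k - 1, 0, 0, 0, 1]}"
    and "F (2 * int s - 2) = {[k, 1, 0, 0, 0]}"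
    and "F (2 * int s - 1) = {[k, 0, 1, 0, 0]}"
    and "F (2 * int s) = {[k, 0, 0, 1, 0], [0, 2, 0, 0, 0]}"
    and "F (2 * int s + 1) = {[2 * k + 1, 0, 0, 0, 0], [0, 1, 1, 0, 0]}"
    and "F (2 * int s + 3) = {[k + 1, 1, 0, 0, 0], [0, 0, 1, 1, 0]}"
proof -
  let ?L = "{(0,0,0,0), (1,0,0,0), (0,1,0,0), (0,0,1,0), (0,0,0,1),
    (2,0,0,0), (1,1,0,0), (1,0,1,0), (1,0,0,1), (0,2,0,0), (0,1,1,0), (0,1,0,1),
    (0,0,2,0), (0,0,1,1), (0,0,0,2)} :: (int \<times> int \<times> int \<times> int) set"
  have F: "\<exists>a b c d e. x = [a, b, c, d, e] \<and> 0 \<le> a \<and>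
      (b, c, d, e) \<in> ?L \<and>
      5 * a + b * (5 * k + 2) + c * (5 * k + 3) + d * (5 * k + 4) + e * (5 * k + 6) = v"
    if x_in: "x \<in> F v" and "v < 3 * int s" for x v
  proof -
    obtain a b c d e where x: "x = [a, b, c, d, e]"
      and nn: "0 \<le> a" "0 \<le> b" "0 \<le> c" "0 \<le> d" "0 \<le> e"
      and eq: "a * int 5 + b * int s + c * int (s + 1) + d * int (s + 2) + e * int (s + 4) = v"
      using x_in unfolding F_def mem_factorizations5_iff by blast
    have sum: "5 * a + b * int s + c * (int s + 1) + d * (int s + 2) + e * (int s + 4) = v"
      using eq by (simp add: add.commute)
    have "0 < int s" using s k by simp
    note mem = at_most_two_large_generators[OF nn this sum that(2)]
    show ?thesis
      by (intro exI conjI, rule x, rule nn, rule mem) (use sum s in \<open>simp add: algebra_simps\<close>)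
  qed
  have F_I: "[a, b, c, d, e] \<in> F v"
    if "0 \<le> a" "0 \<le> b" "0 \<le> c" "0 \<le> d" "0 \<le> e"
      "5 * a + b * (5 * k + 2) + c * (5 * k + 3) + d * (5 * k + 4) + e * (5 * k + 6) = v"
    for a b c d e v
    unfolding F_def mem_factorizations5_iff using that s by (auto simp: algebra_simps)
  have F_eqI: "F v = R" if "v < 3 * int s"
    and "\<And>a b c d e. 0 \<le> a \<Longrightarrow> (b, c, d, e) \<in> ?L \<Longrightarrow>
      5 * a + b * (5 * k + 2) + c * (5 * k + 3) + d * (5 * k + 4) + e * (5 * k + 6) = v \<Longrightarrow>
      [a, b, c, d, e] \<in> R"
    and "R \<subseteq> F v" for v R
  proof (intro equalityI that(3) subsetI)
    fix x assume "x \<in> F v"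
    from F[OF this that(1)] show "x \<in> R"
      by (elim exE conjE) (simp only: that(2))
  qed
  show "F (int s) = {[0, 1, 0, 0, 0]}"
    by (insert k, rule F_eqI, use s in simp, simp only: insert_iff empty_iff prod.inject,
        (elim disjE conjE; simp add: s; presburger?), simp add: s, (intro conjI F_I; simp))
  show "F (int s + 1) = {[0, 0, 1, 0, 0]}"
    by (insert k, rule F_eqI, use s in simp, simp only: insert_iff empty_iff prod.inject,
        (elim disjE conjE; simp add: s; presburger?), simp add: s, (intro conjI F_I; simp))
  show "F (int s + 2) = {[0, 0, 0, 1, 0]}"
    by (insert k, rule F_eqI, use s in simp, simp only: insert_iff empty_iff prod.inject,
        (elim disjE conjE; simp add: s; presburger?), simp add: s, (intro conjI F_I; simp))
  show "F (int s + 4) = {[0, 0, 0, 0, 1]}"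
    by (insert k, rule F_eqI, use s in simp, simp only: insert_iff empty_iff prod.inject,
        (elim disjE conjE; simp add: s; presburger?), simp add: s, (intro conjI F_I; simp))
  show "F (2 * int s - 5) = {[k - 1, 0, 0, 1, 0]}"
    by (insert k, rule F_eqI, use s in simp, simp only: insert_iff empty_iff prod.inject,
        (elim disjE conjE; simp add: s; presburger?), simp add: s, (intro conjI F_I; simp))
  show "F (2 * int s - 4) = {[2 * k, 0, 0, 0, 0]}"
    by (insert k, rule F_eqI, use s in simp, simp only: insert_iff empty_iff prod.inject,
        (elim disjE conjE; simp add: s; presburger?), simp add: s, (intro conjI F_I; simp))
  show "F (2 * int s - 3) = {[k - 1, 0, 0, 0, 1]}"
    by (insert k, rule F_eqI, use s in simp, simp only: insert_iff empty_iff prod.inject,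
        (elim disjE conjE; simp add: s; presburger?), simp add: s, (intro conjI F_I; simp))
  show "F (2 * int s - 2) = {[k, 1, 0, 0, 0]}"
    by (insert k, rule F_eqI, use s in simp, simp only: insert_iff empty_iff prod.inject,
        (elim disjE conjE; simp add: s; presburger?), simp add: s, (intro conjI F_I; simp))
  show "F (2 * int s - 1) = {[k, 0, 1, 0, 0]}"
    by (insert k, rule F_eqI, use s in simp, simp only: insert_iff empty_iff prod.inject,
        (elim disjE conjE; simp add: s; presburger?), simp add: s, (intro conjI F_I; simp))
  show "F (2 * int s) = {[k, 0, 0, 1, 0], [0, 2, 0, 0, 0]}"
    by (insert k, rule F_eqI, use s in simp, simp only: insert_iff empty_iff prod.inject,
        (elim disjE conjE; simp add: s; presburger?), simp add: s, (intro conjI F_I; simp))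
  show "F (2 * int s + 1) = {[2 * k + 1, 0, 0, 0, 0], [0, 1, 1, 0, 0]}"
    by (insert k, rule F_eqI, use s in simp, simp only: insert_iff empty_iff prod.inject,
        (elim disjE conjE; simp add: s; presburger?), simp add: s, (intro conjI F_I; simp))
  show "F (2 * int s + 3) = {[k + 1, 1, 0, 0, 0], [0, 0, 1, 1, 0]}"
    by (insert k, rule F_eqI, use s in simp, simp only: insert_iff empty_iff prod.inject,
        (elim disjE conjE; simp add: s; presburger?), simp add: s, (intro conjI F_I; simp))
qed

theorem proposition3p8:
  fixes S :: "nat set" and s :: nat
  assumes "numerical_semigroup S"
    and "arf S"
    and "multiplicity_of S = 5"
    and "conductor S = int s"
    and "s > 5"
    and "s mod 5 = 2"
  shows "S = generated {5, s, s + 1, s + 2, s + 4}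
    \<and> pseudo_frobenius S = {int s - 5, int s - 4, int s - 3, int s - 1}
    \<and> row_factorization_matrices S (int s - 5) =
        {mat_of_rows_list 5
          [[-1, 1, 0, 0, 0],
           [(int s - 7) div 5, -1, 0, 1, 0],
           [(2 * int s - 4) div 5, 0, -1, 0, 0],
           [(int s - 7) div 5, 0, 0, -1, 1],
           [(int s - 2) div 5, 0, 1, 0, -1]]}
    \<and> row_factorization_matrices S (int s - 4) =
        {mat_of_rows_list 5
          [[-1, 0, 1, 0, 0],
           [(2 * int s - 4) div 5, -1, 0, 0, 0],
           [(int s - 7) div 5, 0, -1, 0, 1],
           [(int s - 2) div 5, 1, 0, -1, 0],
           r5] | r5.
          r5 \<in> {[(int s - 2) div 5, 0, 0, 1, -1], [0, 2, 0, 0, -1]}}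
    \<and> card (row_factorization_matrices S (int s - 4)) = 2
    \<and> row_factorization_matrices S (int s - 3) =
        {mat_of_rows_list 5
          [[-1, 0, 0, 1, 0],
           [(int s - 7) div 5, -1, 0, 0, 1],
           [(int s - 2) div 5, 1, -1, 0, 0],
           [(int s - 2) div 5, 0, 1, -1, 0],
           r5] | r5.
          r5 \<in> {[(2 * int s + 1) div 5, 0, 0, 0, -1], [0, 1, 1, 0, -1]}}
    \<and> card (row_factorization_matrices S (int s - 3)) = 2
    \<and> row_factorization_matrices S (int s - 1) =
        {mat_of_rows_list 5
          [[-1, 0, 0, 0, 1],
           [(int s - 2) div 5, -1, 1, 0, 0],
           r3,
           r4,
           r5] | r3 r4 r5.
          r3 \<in> {[(int s - 2) div 5, 0, -1, 1, 0], [0, 2, -1, 0, 0]} \<and>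
          r4 \<in> {[(2 * int s + 1) div 5, 0, 0, -1, 0], [0, 1, 1, -1, 0]} \<and>
          r5 \<in> {[(int s + 3) div 5, 1, 0, 0, -1], [0, 0, 1, 1, -1]}}
    \<and> card (row_factorization_matrices S (int s - 1)) = 8"
proof -
  have zero: "0 \<in> S" and add: "\<And>x y. x \<in> S \<Longrightarrow> y \<in> S \<Longrightarrow> x + y \<in> S"
    using assms(1) by (auto simp: numerical_semigroup_def)
  \<comment> \<open>In terms of \<open>k\<close> all divisions by 5 in the matrix entries are exact.\<close>
  define k where "k = s div 5"
  have s: "s = 5 * k + 2" using assms(6) unfolding k_def by presburger
  with assms(5) have k: "1 \<le> k" by simp
  have frob: "frobenius_number S = int s - 1" using assms(4) by (simp add: conductor_def)
  have gap: "5 * k + 1 \<notin> S"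
    using frobenius_number_greatest(1)[OF assms(1)] unfolding frob s by force
  have ge: "x \<in> S" if "s \<le> x" for x
    using frobenius_number_greatest(2)[OF assms(1), of "int x"] that unfolding frob by auto
  have "s \<in> S \<and> s \<noteq> 0" using ge assms(5) by simp
  from LeastI[of "\<lambda>x. x \<in> S \<and> x \<noteq> 0", OF this] assms(3)
  have five: "5 \<in> S" by (simp add: multiplicity_of_def)
  have S_eq: "S = {x. 5 dvd x \<or> s \<le> x}"
  proof (intro equalityI subsetI)
    fix x assume "x \<in> S"
    then show "x \<in> {x. 5 dvd x \<or> s \<le> x}"
      using arf_below_conductor[OF add zero assms(2) five gap] s by force
  next
    fix x assume "x \<in> {x. 5 dvd x \<or> s \<le> x}"
    moreover have "5 * n \<in> S" for n
      by (induction n) (use zero add[OF five] in auto)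
    ultimately show "x \<in> S" using ge by auto
  qed
  let ?ns = "[5, s, s + 1, s + 2, s + 4]"
  have "minimal_generators S = set ?ns"
    unfolding S_eq using minimal_generators_multiples_of_5_or_ge[OF s assms(5)] by simp
  then have ns: "sorted_list_of_set (minimal_generators S) = ?ns"
    using assms(5) by (simp only: sorted_list_of_set_sort_remdups) simp
  have upt5: "[0..<5] = [0, 1, 2, 3, 4::nat]" by (simp add: upt_rec)
  have divs: "(int s - 7) div 5 = int k - 1" "(2 * int s - 4) div 5 = 2 * int k"
    "(int s - 2) div 5 = int k" "(2 * int s + 1) div 5 = 2 * int k + 1"
    "(int s + 3) div 5 = int k + 1"
    using s by auto
  have "int s = 5 * int k + 2" "1 \<le> int k" using s k by auto
  note table = factorizations_table[OF this]
  define ns where "ns = ?ns"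
  have row: "rf_rows ns f i = (\<lambda>x. x[i := -1]) ` {x \<in> X. x ! i = 0}"
    if "factorizations ns v = X" "i < 5" "f + int (ns ! i) = v" for f i v X
    using rf_rows_eq_factorizations[of i ns f] that by (simp add: ns_def)
  have nth: "int (ns ! 0) = 5" "int (ns ! Suc 0) = int s" "int (ns ! 2) = int s + 1"
    "int (ns ! 3) = int s + 2" "int (ns ! 4) = int s + 4"
    by (simp_all add: ns_def)
  \<comment> \<open>As conditional rewrite rules these all match every row; the condition \<open>f + n\<^sub>i = v\<close> selects
    the right entry of the table.\<close>
  note rows = table[folded ns_def, THEN row] nth
  have rows1: "map (rf_rows ns (int s - 5)) [0..<5] = [
      {[-1, 1, 0, 0, 0]},
      {[int k - 1, -1, 0, 1, 0]},
      {[2 * int k, 0, -1, 0, 0]},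
      {[int k - 1, 0, 0, -1, 1]},
      {[int k, 0, 1, 0, -1]}]"
    by (simp add: upt5 rows Collect_conv_if conj_disj_distribR Collect_disj_eq insert_commute)
  have rows2: "map (rf_rows ns (int s - 4)) [0..<5] = [
      {[-1, 0, 1, 0, 0]},
      {[2 * int k, -1, 0, 0, 0]},
      {[int k - 1, 0, -1, 0, 1]},
      {[int k, 1, 0, -1, 0]},
      {[int k, 0, 0, 1, -1], [0, 2, 0, 0, -1]}]"
    by (simp add: upt5 rows Collect_conv_if conj_disj_distribR Collect_disj_eq insert_commute)
  have rows3: "map (rf_rows ns (int s - 3)) [0..<5] = [
      {[-1, 0, 0, 1, 0]},
      {[int k - 1, -1, 0, 0, 1]},
      {[int k, 1, -1, 0, 0]},
      {[int k, 0, 1, -1, 0]},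
      {[2 * int k + 1, 0, 0, 0, -1], [0, 1, 1, 0, -1]}]"
    by (simp add: upt5 rows Collect_conv_if conj_disj_distribR Collect_disj_eq insert_commute)
  have rows4: "map (rf_rows ns (int s - 1)) [0..<5] = [
      {[-1, 0, 0, 0, 1]},
      {[int k, -1, 1, 0, 0]},
      {[int k, 0, -1, 1, 0], [0, 2, -1, 0, 0]},
      {[2 * int k + 1, 0, 0, -1, 0], [0, 1, 1, -1, 0]},
      {[int k + 1, 1, 0, 0, -1], [0, 0, 1, 1, -1]}]"
    by (simp add: upt5 rows Collect_conv_if conj_disj_distribR Collect_disj_eq insert_commute)
  have "length ns = 5" by (simp add: ns_def)
  note matrices = row_factorization_matrices_eq[OF ns[folded ns_def] this]
    and card_matrices = card_row_factorization_matrices[OF ns[folded ns_def] this]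
  show ?thesis unfolding divs
  proof (intro conjI)
    show "S = generated {5, s, s + 1, s + 2, s + 4}"
      using generated_multiples_of_5_or_ge[OF s] S_eq by simp
    show "pseudo_frobenius S = {int s - 5, int s - 4, int s - 3, int s - 1}"
      unfolding S_eq by (rule pseudo_frobenius_multiples_of_5_or_ge[OF s assms(5)])
    show "card (row_factorization_matrices S (int s - 4)) = 2"
      "card (row_factorization_matrices S (int s - 3)) = 2"
      "card (row_factorization_matrices S (int s - 1)) = 8"
      unfolding card_matrices rows2 rows3 rows4
      by (simp_all add: set_Cons_insert set_Cons_empty card_insert_if)
  qed (unfold matrices rows1 rows2 rows3 rows4, auto simp: set_Cons_insert set_Cons_empty)
qed

end
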